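(* Let $K$ be a compact Hausdorff space with a nonempty separable open subset $U\subset K$ without isolated points such that every $u\in U$ has a countable neighborhood base. Then the Banach lattice $C(K)$ fails the $oo$-pre-Komlós property.
   Context: $C(K)$ is the real Banach lattice of continuous functions $K\to\mathbb{R}$ with pointwise order and supremum norm. Let $E$ be a real Banach lattice. A sequence $(x_n)$ in $E$ is order bounded if there is $u\in E_+$ with $|x_n|\le u$ for all $n$. A sequence $(x_n)$ in $E$ converges in order to $x\in E$ if there is a sequence $(y_n)$ in $E$ with $y_n\downarrow 0$ (decreasing with infimum $0$ in $E$) such that $|x_n-x|\le y_n$ for all $n$. Correspondingly, $(x_n)$ is $o$-Cauchy if there is a sequence $(y_k)$ in $E$ with $y_k\downarrow 0$ such that $|x_n-x_m|\le y_k$ for all $k$ and all $n,m\ge k$. $E$ has the $oo$-pre-Komlós property if every order bounded sequence $(x_n)$ in $E$ has a subsequence $(x_{n_k})$ such that, for every subsequence $(x_{n_{k_j}})$ of $(x_{n_k})$, the sequence of Cesàro means $\frac1m\sum_{j=1}^m x_{n_{k_j}}$ ($m\in\mathbb{N}$) is $o$-Cauchy. *)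

theory Defs
  imports "HOL-Analysis.Analysis" "HOL-Library.Lattice_Algebras"
begin

class banach_lattice = banach + ordered_real_vector + lattice_ab_group_add_abs +
  assumes norm_abs_mono: "\<bar>x\<bar> \<le> \<bar>y\<bar> \<Longrightarrow> norm x \<le> norm y"

instance real :: banach_lattice
  by standard simp

lemma norm_abs [simp]: "norm \<bar>x\<bar> = norm x" for x :: "'e::banach_lattice"
  by (intro order.antisym norm_abs_mono) simp_all

lemma abs_sup_diff_le:
  fixes a b c d :: "'e::banach_lattice"
  shows "\<bar>sup a b - sup c d\<bar> \<le> \<bar>a - c\<bar> + \<bar>b - d\<bar>"
proof -
  have *: "sup a b - sup c d \<le> \<bar>a - c\<bar> + \<bar>b - d\<bar>" for a b c d :: 'e
  proof -
    have "a - c \<le> \<bar>a - c\<bar> + \<bar>b - d\<bar>"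
      by (rule order_trans[OF abs_ge_self]) simp
    then have a: "a \<le> c + (\<bar>a - c\<bar> + \<bar>b - d\<bar>)"
      by (simp add: diff_le_eq add.commute)
    have "b - d \<le> \<bar>a - c\<bar> + \<bar>b - d\<bar>"
      by (rule order_trans[OF abs_ge_self]) simp
    then have b: "b \<le> d + (\<bar>a - c\<bar> + \<bar>b - d\<bar>)"
      by (simp add: diff_le_eq add.commute)
    have "sup a b \<le> sup c d + (\<bar>a - c\<bar> + \<bar>b - d\<bar>)"
    proof (rule sup_least)
      show "a \<le> sup c d + (\<bar>a - c\<bar> + \<bar>b - d\<bar>)"
        by (rule order_trans[OF a]) (rule add_right_mono, simp)
      show "b \<le> sup c d + (\<bar>a - c\<bar> + \<bar>b - d\<bar>)"
        by (rule order_trans[OF b]) (rule add_right_mono, simp)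
    qed
    then show ?thesis
      by (simp only: diff_le_eq add.commute)
  qed
  show ?thesis
  proof (rule abs_leI[OF *])
    show "- (sup a b - sup c d) \<le> \<bar>a - c\<bar> + \<bar>b - d\<bar>"
      using *[of c d a b] unfolding minus_diff_eq abs_minus_commute[of c a] abs_minus_commute[of d b] .
  qed
qed

lemma norm_sup_diff_le:
  fixes a b c d :: "'e::banach_lattice"
  shows "norm (sup a b - sup c d) \<le> norm (a - c) + norm (b - d)"
proof -
  have "norm (sup a b - sup c d) \<le> norm (\<bar>a - c\<bar> + \<bar>b - d\<bar>)"
  proof (rule norm_abs_mono)
    have "\<bar>\<bar>a - c\<bar> + \<bar>b - d\<bar>\<bar> = \<bar>a - c\<bar> + \<bar>b - d\<bar>"
      by (intro abs_of_nonneg add_nonneg_nonneg abs_ge_zero)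
    then show "\<bar>sup a b - sup c d\<bar> \<le> \<bar>\<bar>a - c\<bar> + \<bar>b - d\<bar>\<bar>"
      using abs_sup_diff_le[of a b c d] by (simp only:)
  qed
  also have "\<dots> \<le> norm \<bar>a - c\<bar> + norm \<bar>b - d\<bar>"
    by (rule norm_triangle_ineq)
  finally show ?thesis by (simp only: norm_abs)
qed

lemma tendsto_sup_banach_lattice:
  fixes f g :: "'a \<Rightarrow> 'e::banach_lattice"
  assumes "(f \<longlongrightarrow> a) F" "(g \<longlongrightarrow> b) F"
  shows "((\<lambda>x. sup (f x) (g x)) \<longlongrightarrow> sup a b) F"
proof -
  have "((\<lambda>x. norm (f x - a) + norm (g x - b)) \<longlongrightarrow> 0 + 0) F"
    using assms[THEN Lim_null[THEN iffD1], THEN tendsto_norm_zero] by (rule tendsto_add)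
  then have "((\<lambda>x. norm (f x - a) + norm (g x - b)) \<longlongrightarrow> 0) F"
    by (simp only: add_0_left)
  then have "((\<lambda>x. sup (f x) (g x) - sup a b) \<longlongrightarrow> 0) F"
    by (rule Lim_null_comparison[OF always_eventually, rotated]) (intro allI norm_sup_diff_le)
  then show ?thesis by (rule Lim_null[THEN iffD2])
qed

text \<open>The library has completeness only over a metric domain.\<close>

instance bcontfun :: (topological_space, complete_space) complete_space
proof
  fix f :: "nat \<Rightarrow> 'a \<Rightarrow>\<^sub>C 'b"
  assume "Cauchy f"
  then obtain g where "uniform_limit UNIV f g sequentially"
    using uniformly_convergent_eq_cauchy[of "\<lambda>_. True" f]
    unfolding Cauchy_def uniform_limit_sequentially_iff
    by (metis dist_fun_lt_imp_dist_val_lt)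
  from uniform_limit_bcontfunE[OF this sequentially_bot]
  show "convergent f"
    by (metis convergentI)
qed

instance bcontfun :: (topological_space, banach) banach ..

setup_lifting type_definition_bcontfun

lemma sup_cont:
  fixes f g :: "'a::topological_space \<Rightarrow> 'e::banach_lattice"
  assumes "f \<in> bcontfun" "g \<in> bcontfun"
  shows "(\<lambda>x. sup (f x) (g x)) \<in> bcontfun"
proof -
  from assms obtain B C where B: "\<And>x. norm (f x) \<le> B" and C: "\<And>x. norm (g x) \<le> C"
    by (auto simp: bcontfun_def bounded_iff)
  have "norm (sup (f x) (g x)) \<le> B + C" for x
    using norm_sup_diff_le[of "f x" "g x" 0 0] B[of x] C[of x] by simp
  moreover have "continuous_on UNIV (\<lambda>x. sup (f x) (g x))"
    using assms by (auto simp: bcontfun_def continuous_on_def intro!: tendsto_sup_banach_lattice)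
  ultimately show ?thesis by (rule bcontfun_normI[rotated])
qed

lemma inf_cont:
  fixes f g :: "'a::topological_space \<Rightarrow> 'e::banach_lattice"
  assumes "f \<in> bcontfun" "g \<in> bcontfun"
  shows "(\<lambda>x. inf (f x) (g x)) \<in> bcontfun"
  unfolding inf_eq_neg_sup by (intro uminus_cont sup_cont assms)

lemma abs_cont:
  fixes f :: "'a::topological_space \<Rightarrow> 'e::banach_lattice"
  assumes "f \<in> bcontfun"
  shows "(\<lambda>x. \<bar>f x\<bar>) \<in> bcontfun"
  unfolding abs_lattice by (intro uminus_cont sup_cont assms)

instantiation bcontfun :: (topological_space, banach_lattice) banach_lattice
begin

lift_definition less_eq_bcontfun :: "('a \<Rightarrow>\<^sub>C 'b) \<Rightarrow> ('a \<Rightarrow>\<^sub>C 'b) \<Rightarrow> bool"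
  is "\<lambda>f g. \<forall>x. f x \<le> g x" .

definition less_bcontfun :: "('a \<Rightarrow>\<^sub>C 'b) \<Rightarrow> ('a \<Rightarrow>\<^sub>C 'b) \<Rightarrow> bool"
  where "less_bcontfun f g \<longleftrightarrow> f \<le> g \<and> \<not> g \<le> f"

lift_definition sup_bcontfun :: "('a \<Rightarrow>\<^sub>C 'b) \<Rightarrow> ('a \<Rightarrow>\<^sub>C 'b) \<Rightarrow> 'a \<Rightarrow>\<^sub>C 'b"
  is "\<lambda>f g x. sup (f x) (g x)" by (rule sup_cont)

lift_definition inf_bcontfun :: "('a \<Rightarrow>\<^sub>C 'b) \<Rightarrow> ('a \<Rightarrow>\<^sub>C 'b) \<Rightarrow> 'a \<Rightarrow>\<^sub>C 'b"
  is "\<lambda>f g x. inf (f x) (g x)" by (rule inf_cont)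

lift_definition abs_bcontfun :: "('a \<Rightarrow>\<^sub>C 'b) \<Rightarrow> 'a \<Rightarrow>\<^sub>C 'b"
  is "\<lambda>f x. \<bar>f x\<bar>" by (rule abs_cont)

instance
proof
  fix f g h :: "'a \<Rightarrow>\<^sub>C 'b" and a b :: real
  show "f < g \<longleftrightarrow> f \<le> g \<and> \<not> g \<le> f"
    by (rule less_bcontfun_def)
  show "f \<le> f"
    by transfer simp
  show "f \<le> h" if "f \<le> g" "g \<le> h"
    using that by transfer (blast intro: order_trans)
  show "f = g" if "f \<le> g" "g \<le> f"
    using that by transfer (auto intro!: ext order.antisym)
  show "inf f g \<le> f" "inf f g \<le> g" "f \<le> sup f g" "g \<le> sup f g"
    by (transfer; simp)+
  show "f \<le> inf g h" if "f \<le> g" "f \<le> h"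
    using that by transfer simp
  show "sup g h \<le> f" if "g \<le> f" "h \<le> f"
    using that by transfer simp
  show "h + f \<le> h + g" if "f \<le> g"
    using that by (simp add: less_eq_bcontfun.rep_eq)
  show "a *\<^sub>R f \<le> a *\<^sub>R g" if "f \<le> g" "0 \<le> a"
    using that by (simp add: less_eq_bcontfun.rep_eq scaleR_left_mono)
  show "a *\<^sub>R f \<le> b *\<^sub>R f" if "a \<le> b" "0 \<le> f"
    using that by (simp add: less_eq_bcontfun.rep_eq scaleR_right_mono)
  show "\<bar>f\<bar> = sup f (- f)"
    by (rule bcontfun_eqI) (simp add: abs_bcontfun.rep_eq sup_bcontfun.rep_eq abs_lattice)
  show "norm f \<le> norm g" if "\<bar>f\<bar> \<le> \<bar>g\<bar>"
  proof -
    have "norm (f x) \<le> norm (g x)" for x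
      using that by (simp add: less_eq_bcontfun.rep_eq abs_bcontfun.rep_eq norm_abs_mono)
    then show ?thesis
      by (meson norm_bound norm_bounded order_trans)
  qed
qed

end

lemmas [simp] = sup_bcontfun.rep_eq inf_bcontfun.rep_eq abs_bcontfun.rep_eq

lifting_update bcontfun.lifting
lifting_forget bcontfun.lifting

text \<open>
  On a compact space every continuous real function is bounded, so \<^typ>\<open>'k \<Rightarrow>\<^sub>C real\<close> is
  the whole of $C(K)$ when the type \<^typ>\<open>'k\<close> is compact.
\<close>

lemma compact_continuous_in_bcontfun:
  fixes f :: "'k::topological_space \<Rightarrow> real"
  assumes "compact (UNIV :: 'k set)" "continuous_on UNIV f"
  shows "f \<in> bcontfun"
  using assms by (auto simp: bcontfun_def intro: compact_imp_bounded compact_continuous_image)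

definition decreases_to_zero :: "(nat \<Rightarrow> 'e::banach_lattice) \<Rightarrow> bool" where
  "decreases_to_zero y \<longleftrightarrow>
     decseq y \<and> (\<forall>n. 0 \<le> y n) \<and> (\<forall>z. (\<forall>n. z \<le> y n) \<longrightarrow> z \<le> 0)"

definition order_bounded :: "(nat \<Rightarrow> 'e::banach_lattice) \<Rightarrow> bool" where
  "order_bounded x \<longleftrightarrow> (\<exists>u\<ge>0. \<forall>n. \<bar>x n\<bar> \<le> u)"

definition o_Cauchy :: "(nat \<Rightarrow> 'e::banach_lattice) \<Rightarrow> bool" where
  "o_Cauchy x \<longleftrightarrow>
     (\<exists>y. decreases_to_zero y \<and> (\<forall>k. \<forall>n\<ge>k. \<forall>m\<ge>k. \<bar>x n - x m\<bar> \<le> y k))"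

text \<open>Sequences are indexed from 0, so entry \<open>m\<close> is the mean of the first \<open>m + 1\<close> terms.\<close>

definition cesaro_means :: "(nat \<Rightarrow> 'e::banach_lattice) \<Rightarrow> nat \<Rightarrow> 'e" where
  "cesaro_means x m = (1 / real (Suc m)) *\<^sub>R (\<Sum>j\<le>m. x j)"

definition oo_pre_Komlos :: "'e::banach_lattice itself \<Rightarrow> bool" where
  "oo_pre_Komlos (_ :: 'e itself) \<longleftrightarrow>
     (\<forall>x :: nat \<Rightarrow> 'e. order_bounded x \<longrightarrow>
        (\<exists>r :: nat \<Rightarrow> nat. strict_mono r \<and>
           (\<forall>s :: nat \<Rightarrow> nat. strict_mono s \<longrightarrow> o_Cauchy (cesaro_means (x \<circ> r \<circ> s)))))"

definition has_countable_nhds_base :: "'a::topological_space \<Rightarrow> bool" where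
  "has_countable_nhds_base x \<longleftrightarrow>
     (\<exists>B. countable B \<and> (\<forall>N\<in>B. x \<in> interior N) \<and>
        (\<forall>M. x \<in> interior M \<longrightarrow> (\<exists>N\<in>B. N \<subseteq> M)))"

end

theory Submission
  imports Defs
begin

text \<open>
  The regulator \<open>y\<close> of an \<open>o\<close>-Cauchy sequence \<open>c\<close> in \<open>C(K)\<close> cannot be bounded below by a positive
  constant on a nonempty open set, since a Urysohn function would then be a positive lower bound;
  so \<open>c\<close> cannot oscillate by a fixed amount, arbitrarily late, at points of a dense subset of \<open>U\<close>.
  The hypotheses on \<open>U\<close> provide a countable \<open>\<pi>\<close>-base \<open>V\<^sub>0, V\<^sub>1, \<dots>\<close> of infinite open sets. Along it one
  builds an analogue of the Rademacher functions: a sequence \<open>x\<^sub>n : K \<rightarrow> [0, 1]\<close> such that on each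
  \<open>V\<^sub>l\<close> the functions \<open>x\<^sub>n\<close> with \<open>n \<ge> l\<close> realise every finite pattern of values above \<open>3/4\<close> and
  below \<open>1/4\<close>. For every subsequence, a long run of high values followed by a much longer run of
  low values makes the Cesaro means oscillate by at least \<open>1/8\<close> somewhere in \<open>V\<^sub>l\<close>.
\<close>

section \<open>Separation, transversals and a countable \<pi>-base\<close>

lemma Urysohn_bcontfun:
  fixes S T :: "'k::t2_space set"
  assumes "compact (UNIV :: 'k set)" "closed S" "closed T" "S \<inter> T = {}"
  obtains f :: "'k \<Rightarrow>\<^sub>C real"
  where "\<And>t. 0 \<le> f t" "\<And>t. f t \<le> 1" "\<And>t. t \<in> S \<Longrightarrow> f t = 0" "\<And>t. t \<in> T \<Longrightarrow> f t = 1"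
proof -
  have "compact_space (euclidean :: 'k topology)"
    using assms(1) by (simp add: compact_space_def)
  moreover have "Hausdorff_space (euclidean :: 'k topology)"
    unfolding Hausdorff_space_def disjnt_def by (simp, meson hausdorff)
  ultimately have "normal_space (euclidean :: 'k topology)"
    by (simp add: compact_Hausdorff_or_regular_imp_normal_space)
  then obtain f :: "'k \<Rightarrow> real" where f: "continuous_map euclidean (top_of_set {0..1}) f"
      "f ` S \<subseteq> {0}" "f ` T \<subseteq> {1}"
    using Urysohn_lemma[of euclidean S T 0 1] assms by (auto simp: disjnt_def)
  then have range: "f t \<in> {0..1}" for t
    by (auto simp: continuous_map_in_subtopology)
  have "continuous_on UNIV f"
    using f(1) by (auto simp: continuous_map_in_subtopology)
  then obtain g where "f = apply_bcontfun g"
    using compact_continuous_in_bcontfun[OF assms(1)] bcontfunE by metis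
  with f range show thesis
    by (intro that[of g]) auto
qed

text \<open>Points are picked greedily: an infinite set always has a point outside the finitely many
  already chosen. Finiteness of \<open>P\<close> and \<open>Q\<close> makes them closed in a
  Hausdorff space, so that Urysohn's lemma can separate them.\<close>

lemma finite_disjoint_transversals:
  assumes "finite F" "\<And>W. W \<in> F \<Longrightarrow> infinite W"
  obtains P Q where "finite P" "finite Q" "P \<inter> Q = {}"
    "\<And>W. W \<in> F \<Longrightarrow> W \<inter> P \<noteq> {}" "\<And>W. W \<in> F \<Longrightarrow> W \<inter> Q \<noteq> {}"
proof -
  have "\<exists>P Q. finite P \<and> finite Q \<and> P \<inter> Q = {} \<and> (\<forall>W\<in>F. W \<inter> P \<noteq> {} \<and> W \<inter> Q \<noteq> {})"
    using assms
  proof (induction F rule: finite_induct)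
    case empty
    show ?case by (intro exI[of _ "{}"]) simp
  next
    case (insert W F)
    then obtain P Q where PQ: "finite P" "finite Q" "P \<inter> Q = {}"
        "\<forall>W\<in>F. W \<inter> P \<noteq> {} \<and> W \<inter> Q \<noteq> {}"
      by auto
    from insert.prems have W: "infinite W" by simp
    have fresh: "\<exists>p\<in>W. p \<notin> A" if "finite A" for A
      using W that finite_subset[of W A] by blast
    obtain p where p: "p \<in> W" "p \<notin> P \<union> Q"
      using fresh[of "P \<union> Q"] PQ(1,2) by blast
    obtain q where q: "q \<in> W" "q \<notin> insert p (P \<union> Q)"
      using fresh[of "insert p (P \<union> Q)"] PQ(1,2) by blast
    show ?case
      using PQ p q by (intro exI[of _ "insert p P"] exI[of _ "insert q Q"]) auto
  qed
  then obtain P Q where "finite P" "finite Q" "P \<inter> Q = {}"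
      "\<forall>W\<in>F. W \<inter> P \<noteq> {} \<and> W \<inter> Q \<noteq> {}"
    by (elim exE conjE)
  then show thesis by (intro that) auto
qed

text \<open>If \<open>W\<close> were finite, removing from it the closed set of all its points but
  one would leave an open singleton, and that point would be isolated in \<open>U\<close>.\<close>

lemma infinite_open_of_not_isolated:
  fixes U W :: "'k::t1_space set"
  assumes "\<forall>u\<in>U. \<not> u isolated_in U" "open W" "W \<noteq> {}" "W \<subseteq> U"
  shows "infinite W"
proof
  assume "finite W"
  obtain w where "w \<in> W" using assms(3) by blast
  have "open (W - (W - {w}))"
    using assms(2) \<open>finite W\<close> by (intro open_Diff finite_imp_closed) auto
  moreover have "(W - (W - {w})) \<inter> U = {w}"
    using \<open>w \<in> W\<close> assms(4) by auto
  ultimately show False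
    using \<open>w \<in> W\<close> assms(1,4) unfolding isolated_in_def by blast
qed

lemma countable_pi_base:
  fixes U :: "'k::topological_space set"
  assumes "open U" "U \<noteq> {}" "separable_space (top_of_set U)"
    and "\<forall>u\<in>U. has_countable_nhds_base u"
  obtains V :: "nat \<Rightarrow> 'k set"
  where "\<And>l. open (V l)" "\<And>l. V l \<noteq> {}" "\<And>l. V l \<subseteq> U"
    "\<And>W. open W \<Longrightarrow> W \<noteq> {} \<Longrightarrow> W \<subseteq> U \<Longrightarrow> \<exists>l. V l \<subseteq> W"
proof -
  obtain D where D: "countable D" "D \<subseteq> U" "top_of_set U closure_of D = U"
    using assms(3) unfolding separable_space_def by auto
  have dense: "D \<inter> W \<noteq> {}" if "open W" "W \<noteq> {}" "W \<subseteq> U" for W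
  proof -
    have "openin (top_of_set U) W"
      using that assms(1) by (simp add: openin_open_eq)
    then have "W \<inter> top_of_set U closure_of D = {} \<longleftrightarrow> W \<inter> D = {}"
      by (rule openin_Int_closure_of_eq_empty)
    with D(3) that show ?thesis by auto
  qed
  from assms(4) obtain B where B: "\<And>u. u \<in> U \<Longrightarrow> countable (B u)"
      "\<And>u N. u \<in> U \<Longrightarrow> N \<in> B u \<Longrightarrow> u \<in> interior N"
      "\<And>u M. u \<in> U \<Longrightarrow> u \<in> interior M \<Longrightarrow> \<exists>N\<in>B u. N \<subseteq> M"
    unfolding has_countable_nhds_base_def by metis
  \<comment> \<open>Members of a local base may be non-open and may leave \<open>U\<close>, hence
    the interiors cut down to \<open>U\<close>. Local bases at the points of \<open>D\<close>
    suffice: every nonempty open \<open>W\<close> inside \<open>U\<close> contains some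
    \<open>d\<close> in \<open>D\<close>, and then a base member at \<open>d\<close> lies in
    \<open>W\<close>.\<close>
  define \<V> where "\<V> = (\<Union>d\<in>D. (\<lambda>N. interior N \<inter> U) ` B d)"
  have count: "countable \<V>"
    unfolding \<V>_def using D B(1) by (intro countable_UN countable_image) auto
  have mem: "open V \<and> V \<noteq> {} \<and> V \<subseteq> U" if "V \<in> \<V>" for V
    using that D(2) B(2) assms(1) unfolding \<V>_def by fastforce
  have base: "\<exists>V\<in>\<V>. V \<subseteq> W" if W: "open W" "W \<noteq> {}" "W \<subseteq> U" for W
  proof -
    obtain d where d: "d \<in> D" "d \<in> W" using dense[OF W] by blast
    then have "d \<in> interior W" "d \<in> U" using W by (auto simp: interior_open)
    then obtain N where N: "N \<in> B d" "N \<subseteq> W" using B(3) by blast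
    then have "interior N \<inter> U \<subseteq> W" using interior_subset by blast
    with N d show ?thesis unfolding \<V>_def by blast
  qed
  have ne: "\<V> \<noteq> {}" using base[of U] assms by blast
  show thesis
  proof (rule that[of "from_nat_into \<V>"])
    show "\<exists>l. from_nat_into \<V> l \<subseteq> W" if "open W" "W \<noteq> {}" "W \<subseteq> U" for W
      using base[OF that] from_nat_into_surj[OF count] by metis
  qed (use mem from_nat_into[OF ne] in blast)+
qed

section \<open>Rademacher-like functions along the \<pi>-base\<close>

lemma splitting_function:
  fixes \<W> :: "'k::t2_space set set"
  assumes "compact (UNIV :: 'k set)" "finite \<W>" "\<And>W. W \<in> \<W> \<Longrightarrow> infinite W"
  obtains f :: "'k \<Rightarrow>\<^sub>C real"
  where "\<And>t. 0 \<le> f t" "\<And>t. f t \<le> 1"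
    "\<And>W. W \<in> \<W> \<Longrightarrow> \<exists>t\<in>W. f t = 0" "\<And>W. W \<in> \<W> \<Longrightarrow> \<exists>t\<in>W. f t = 1"
proof -
  obtain P Q where PQ: "finite P" "finite Q" "P \<inter> Q = {}"
    and meet: "\<And>W. W \<in> \<W> \<Longrightarrow> W \<inter> P \<noteq> {}" "\<And>W. W \<in> \<W> \<Longrightarrow> W \<inter> Q \<noteq> {}"
    using finite_disjoint_transversals[OF assms(2,3)] by metis
  obtain f :: "'k \<Rightarrow>\<^sub>C real" where "\<And>t. 0 \<le> f t" "\<And>t. f t \<le> 1"
      "\<And>t. t \<in> P \<Longrightarrow> f t = 0" "\<And>t. t \<in> Q \<Longrightarrow> f t = 1"
    using Urysohn_bcontfun[OF assms(1) PQ(1,2)[THEN finite_imp_closed] PQ(3)] by metis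
  with meet show thesis
    by (intro that[of f]) (simp_all, blast+)
qed

text \<open>Strict inequalities keep these sets open, so they can be split again; the gap between
  the thresholds is what makes the means oscillate.\<close>

definition high_low :: "('k \<Rightarrow> real) \<Rightarrow> bool \<Rightarrow> 'k set" where
  "high_low f b = (if b then {t. 3 / 4 < f t} else {t. f t < 1 / 4})"

lemma open_high_low:
  fixes f :: "'k::topological_space \<Rightarrow>\<^sub>C real"
  shows "open (high_low f b)"
proof -
  have "continuous_on UNIV f" by simp
  then show ?thesis
    unfolding high_low_def by (cases b) (simp_all only: if_True if_False open_Collect_less continuous_on_const)
qed

text \<open>At stage \<open>n\<close> the function \<open>x n\<close> splits every member of a
  finite family of nonempty open subsets of \<open>U\<close>. The high and low parts of all members,
  together with \<open>V (Suc n)\<close>, form the next family; its members are again infinite, so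
  the construction continues. As \<open>V l\<close> joins at stage \<open>l\<close>, only indices
  from \<open>l\<close> on are controlled on it.\<close>

lemma pattern_sequence:
  fixes V :: "nat \<Rightarrow> 'k::t2_space set"
  assumes "compact (UNIV :: 'k set)"
    and U: "\<forall>u\<in>U. \<not> u isolated_in U"
    and V: "\<And>l. open (V l)" "\<And>l. V l \<noteq> {}" "\<And>l. V l \<subseteq> U"
  obtains x :: "nat \<Rightarrow> 'k \<Rightarrow>\<^sub>C real"
  where "\<And>n t. 0 \<le> x n t" "\<And>n t. x n t \<le> 1"
    "\<And>l N b. \<exists>t\<in>V l. \<forall>i\<in>{l..<N}. t \<in> high_low (x i) (b i)"
proof -
  define good where "good W \<longleftrightarrow> open W \<and> W \<noteq> {} \<and> W \<subseteq> U" for W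
  \<comment> \<open>A state pairs the family with the function splitting it; \<open>Q\<close> passes
    both parts of every member on to the next family.\<close>
  define P where "P n p \<longleftrightarrow>
      finite (fst p) \<and> V n \<in> fst p \<and> (\<forall>W\<in>fst p. good W) \<and> (\<forall>t. 0 \<le> snd p t \<and> snd p t \<le> 1) \<and>
      (\<forall>W\<in>fst p. \<forall>b. W \<inter> high_low (snd p) b \<noteq> {})"
    for n and p :: "'k set set \<times> ('k \<Rightarrow>\<^sub>C real)"
  define Q where "Q p q \<longleftrightarrow> (\<forall>W\<in>fst p. \<forall>b. W \<inter> high_low (snd p) b \<in> fst q)"
    for p q :: "'k set set \<times> ('k \<Rightarrow>\<^sub>C real)"
  have goodV: "good (V n)" for n
    using V by (simp add: good_def)
  have ex: "\<exists>f. P n (\<W>, f)" if \<W>: "finite \<W>" "V n \<in> \<W>" "\<forall>W\<in>\<W>. good W" for n \<W>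
  proof -
    have "infinite W" if "W \<in> \<W>" for W
      using \<W>(3) that infinite_open_of_not_isolated[OF U] unfolding good_def by blast
    then obtain f :: "'k \<Rightarrow>\<^sub>C real" where f: "\<And>t. 0 \<le> f t" "\<And>t. f t \<le> 1"
        "\<And>W. W \<in> \<W> \<Longrightarrow> \<exists>t\<in>W. f t = 0" "\<And>W. W \<in> \<W> \<Longrightarrow> \<exists>t\<in>W. f t = 1"
      using splitting_function[OF assms(1) \<W>(1)] by metis
    have "W \<inter> high_low f b \<noteq> {}" if "W \<in> \<W>" for W b
      using f(3,4)[OF that] by (cases b) (force simp: high_low_def)+
    with f \<W> show ?thesis
      unfolding P_def by (intro exI[of _ f]) simp
  qed
  have "\<exists>p. \<forall>n. P n (p n) \<and> Q (p n) (p (Suc n))"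
  proof (rule dependent_nat_choice)
    show "\<exists>p. P 0 p"
      using ex[of "{V 0}" 0] goodV by auto
  next
    fix p n assume p: "P n p"
    define \<W> where "\<W> = insert (V (Suc n)) ((\<lambda>(W, b). W \<inter> high_low (snd p) b) ` (fst p \<times> UNIV))"
    have "finite \<W>"
      using p unfolding \<W>_def P_def by auto
    moreover have "\<forall>W\<in>\<W>. good W"
      using p goodV unfolding \<W>_def P_def good_def by (auto intro: open_high_low)
    ultimately obtain f where "P (Suc n) (\<W>, f)"
      using ex[of \<W> "Suc n"] unfolding \<W>_def by auto
    moreover have "Q p (\<W>, f)"
      unfolding Q_def \<W>_def by force
    ultimately show "\<exists>q. P (Suc n) q \<and> Q p q" by blast
  qed
  then obtain p where p: "\<And>n. P n (p n)" "\<And>n. Q (p n) (p (Suc n))" by blast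
  \<comment> \<open>Start from \<open>V l\<close> in the family of stage \<open>l\<close> and follow
    the part prescribed by \<open>b\<close> at each stage. The set reached is a member of a family,
    hence nonempty.\<close>
  have pattern: "\<exists>W\<in>fst (p (l + d)). W \<subseteq> V l \<and> (\<forall>i\<in>{l..<l + d}. W \<subseteq> high_low (snd (p i)) (b i))"
    for l d and b :: "nat \<Rightarrow> bool"
  proof (induction d)
    case 0
    show ?case using p(1)[of l] unfolding P_def by auto
  next
    case (Suc d)
    then obtain W where W: "W \<in> fst (p (l + d))" "W \<subseteq> V l"
        "\<forall>i\<in>{l..<l + d}. W \<subseteq> high_low (snd (p i)) (b i)" by blast
    let ?W = "W \<inter> high_low (snd (p (l + d))) (b (l + d))"
    have "?W \<in> fst (p (l + Suc d))"
      using p(2)[of "l + d"] W(1) unfolding Q_def by simp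
    moreover have "?W \<subseteq> high_low (snd (p i)) (b i)" if "i \<in> {l..<l + Suc d}" for i
      using that W(3) by (cases "i = l + d") auto
    ultimately show ?case using W(2) by (intro bexI[of _ ?W]) auto
  qed
  show thesis
  proof (rule that[of "\<lambda>n. snd (p n)"])
    fix l N and b :: "nat \<Rightarrow> bool"
    \<comment> \<open>Subtraction is truncated: for \<open>N \<le> l\<close> the number of steps is
      0 and no index is constrained.\<close>
    obtain W where W: "W \<in> fst (p (l + (N - l)))" "W \<subseteq> V l"
        "\<forall>i\<in>{l..<l + (N - l)}. W \<subseteq> high_low (snd (p i)) (b i)"
      using pattern[of l "N - l" b] by (elim bexE conjE)
    have "W \<noteq> {}"
      using p(1)[of "l + (N - l)"] W(1) unfolding P_def good_def by simp
    then obtain t where "t \<in> W" by auto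
    with W show "\<exists>t\<in>V l. \<forall>i\<in>{l..<N}. t \<in> high_low (snd (p i)) (b i)"
      by (intro bexI[of _ t]) auto
  qed (use p(1) in \<open>auto simp: P_def\<close>)
qed

section \<open>Oscillating means and the failure of order Cauchyness\<close>

lemma cesaro_means_bcontfun:
  fixes x :: "nat \<Rightarrow> 'k::topological_space \<Rightarrow>\<^sub>C real"
  shows "cesaro_means x n t = cesaro_means (\<lambda>j. x j t) n"
proof -
  have "(\<Sum>j\<in>A. x j) t = (\<Sum>j\<in>A. x j t)" if "finite A" for A
    using that by induction auto
  then show ?thesis by (simp add: cesaro_means_def)
qed

text \<open>At most a quarter of the first \<open>Suc n\<close> terms precede \<open>l\<close>, so
  the mean at \<open>n\<close> is at least 3/4 * 3/4 = 9/16. At \<open>m\<close> the first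
  \<open>Suc n\<close> terms contribute at most 1/8 and the low ones at most 1/4, together 3/8. The
  difference 3/16 exceeds 1/8.\<close>

lemma cesaro_means_oscillate:
  fixes a :: "nat \<Rightarrow> real"
  assumes bounds: "\<And>j. 0 \<le> a j" "\<And>j. a j \<le> 1"
    and high: "\<And>j. l \<le> j \<Longrightarrow> j \<le> n \<Longrightarrow> 3 / 4 \<le> a j"
    and low: "\<And>j. n < j \<Longrightarrow> j \<le> m \<Longrightarrow> a j \<le> 1 / 4"
    and "4 * l \<le> Suc n" and "8 * Suc n \<le> Suc m"
  shows "1 / 8 \<le> \<bar>cesaro_means a n - cesaro_means a m\<bar>"
proof -
  have "l \<le> Suc n" "n < m" using assms(5,6) by auto
  have "3 / 4 * real (Suc n - l) = (\<Sum>j\<in>{l..n}. 3 / 4)" by simp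
  also have "\<dots> \<le> (\<Sum>j\<in>{l..n}. a j)" by (rule sum_mono) (use high in auto)
  also have "\<dots> \<le> (\<Sum>j\<le>n. a j)" by (rule sum_mono2) (use bounds in auto)
  finally have "3 / 4 * real (Suc n) - 3 / 4 * real l \<le> (\<Sum>j\<le>n. a j)"
    using \<open>l \<le> Suc n\<close> by (simp only: of_nat_diff right_diff_distrib)
  moreover have "4 * real l \<le> real (Suc n)" using assms(5) by linarith
  ultimately have "9 / 16 * real (Suc n) \<le> (\<Sum>j\<le>n. a j)" by argo
  then have n: "9 / 16 \<le> cesaro_means a n"
    unfolding cesaro_means_def by (simp add: field_simps)
  have m: "{..m} = {..n} \<union> {n<..m}" using \<open>n < m\<close> by auto
  have "(\<Sum>j\<le>m. a j) = (\<Sum>j\<le>n. a j) + (\<Sum>j\<in>{n<..m}. a j)"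
    unfolding m by (rule sum.union_disjoint) auto
  also have "\<dots> \<le> (\<Sum>j\<le>n. 1) + (\<Sum>j\<in>{n<..m}. 1 / 4)"
    by (intro add_mono sum_mono) (use bounds low in auto)
  also have "\<dots> = real (Suc n) + (real m - real n) / 4"
    using \<open>n < m\<close> by (simp add: of_nat_diff)
  also have "\<dots> \<le> 3 / 8 * real (Suc m)"
  proof -
    have "8 * n + 7 \<le> m" using assms(6) by simp
    then have "real (8 * n + 7) \<le> real m" by (rule of_nat_mono)
    then show ?thesis by (simp add: field_simps)
  qed
  finally have "cesaro_means a m \<le> 3 / 8"
    unfolding cesaro_means_def by (simp add: field_simps)
  with n show ?thesis by linarith
qed

lemma not_o_Cauchy_of_dense_oscillation:
  fixes c :: "nat \<Rightarrow> 'k::t2_space \<Rightarrow>\<^sub>C real"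
  assumes "compact (UNIV :: 'k set)" "open U" "U \<noteq> {}" "0 < e"
    and osc: "\<And>k W. open W \<Longrightarrow> W \<noteq> {} \<Longrightarrow> W \<subseteq> U \<Longrightarrow>
      \<exists>t\<in>W. \<exists>n\<ge>k. \<exists>m\<ge>k. e \<le> \<bar>c n t - c m t\<bar>"
  shows "\<not> o_Cauchy c"
proof
  assume "o_Cauchy c"
  then obtain y where y: "decreases_to_zero y"
      "\<And>k n m. k \<le> n \<Longrightarrow> k \<le> m \<Longrightarrow> \<bar>c n - c m\<bar> \<le> y k"
    unfolding o_Cauchy_def by blast
  have y0: "0 \<le> y k t" for k t
    using y(1) unfolding decreases_to_zero_def by (simp add: less_eq_bcontfun.rep_eq)
  \<comment> \<open>By continuity, \<open>y k u < e\<close> would persist on a neighbourhood of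
    \<open>u\<close> in \<open>U\<close>, which contains a point where \<open>c\<close> oscillates
    by \<open>e\<close> beyond \<open>k\<close>.\<close>
  have ye: "e \<le> y k u" if "u \<in> U" for k u
  proof (rule ccontr)
    assume "\<not> e \<le> y k u"
    define W where "W = U \<inter> {t. y k t < e}"
    have "continuous_on UNIV (y k)" by simp
    then have "open W"
      unfolding W_def using assms(2) by (intro open_Int open_Collect_less continuous_on_const) auto
    moreover have "u \<in> W" "W \<subseteq> U"
      unfolding W_def using that \<open>\<not> e \<le> y k u\<close> by auto
    ultimately obtain t n m where t: "t \<in> W" "k \<le> n" "k \<le> m" "e \<le> \<bar>c n t - c m t\<bar>"
      using osc[of W k] by blast
    have "\<bar>c n t - c m t\<bar> \<le> y k t"
      using y(2)[OF t(2,3)] by (simp add: less_eq_bcontfun.rep_eq)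
    with t show False unfolding W_def by auto
  qed
  obtain u where u: "u \<in> U" using assms(3) by blast
  \<comment> \<open>Off \<open>U\<close> only \<open>0 \<le> y k\<close> is known, so the lower
    bound \<open>e *\<^sub>R g\<close> must vanish there; its value \<open>e\<close> at
    \<open>u\<close> contradicts the infimum being 0.\<close>
  obtain g :: "'k \<Rightarrow>\<^sub>C real" where g: "\<And>t. 0 \<le> g t" "\<And>t. g t \<le> 1"
      "\<And>t. t \<in> - U \<Longrightarrow> g t = 0" "\<And>t. t \<in> {u} \<Longrightarrow> g t = 1"
    using Urysohn_bcontfun[OF assms(1), of "- U" "{u}"] assms(2) u by auto
  have "e * g t \<le> y k t" for k t
  proof (cases "t \<in> U")
    case True
    have "e * g t \<le> e * 1" using assms(4) g(2) by (intro mult_left_mono) auto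
    with ye[OF True, of k] show ?thesis by linarith
  qed (simp add: g(3) y0)
  then have "\<forall>k. e *\<^sub>R g \<le> y k" by (simp add: less_eq_bcontfun.rep_eq)
  then have "e *\<^sub>R g \<le> 0" using y(1) unfolding decreases_to_zero_def by blast
  then have "e * g u \<le> 0" by (simp add: less_eq_bcontfun.rep_eq)
  with g(4)[of u] assms(4) show False by simp
qed

theorem theorem3:
  fixes U :: "'k::t2_space set"
  assumes "compact (UNIV :: 'k set)"
    and "open U" and "U \<noteq> {}"
    and "separable_space (top_of_set U)"
    and "\<forall>u\<in>U. \<not> u isolated_in U"
    and "\<forall>u\<in>U. has_countable_nhds_base u"
  shows "\<not> oo_pre_Komlos TYPE('k \<Rightarrow>\<^sub>C real)"
proof
  assume Komlos: "oo_pre_Komlos TYPE('k \<Rightarrow>\<^sub>C real)"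
  obtain V :: "nat \<Rightarrow> 'k set" where V: "\<And>l. open (V l)" "\<And>l. V l \<noteq> {}" "\<And>l. V l \<subseteq> U"
    and base: "\<And>W. open W \<Longrightarrow> W \<noteq> {} \<Longrightarrow> W \<subseteq> U \<Longrightarrow> \<exists>l. V l \<subseteq> W"
    using countable_pi_base[OF assms(2,3,4,6)] by metis
  obtain x :: "nat \<Rightarrow> 'k \<Rightarrow>\<^sub>C real" where x: "\<And>n t. 0 \<le> x n t" "\<And>n t. x n t \<le> 1"
    and pattern: "\<And>l N b. \<exists>t\<in>V l. \<forall>i\<in>{l..<N}. t \<in> high_low (x i) (b i)"
    using pattern_sequence[OF assms(1,5), of V] V by metis
  have "order_bounded x"
    unfolding order_bounded_def
    by (intro exI[of _ "const_bcontfun 1"])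
      (use x in \<open>auto simp: less_eq_bcontfun.rep_eq\<close>)
  with Komlos obtain r :: "nat \<Rightarrow> nat" where r: "strict_mono r"
    and "\<And>s. strict_mono s \<Longrightarrow> o_Cauchy (cesaro_means (x \<circ> r \<circ> s))"
    unfolding oo_pre_Komlos_def by blast
  \<comment> \<open>The pattern argument works for every strictly increasing \<open>r\<close>, so
    the trivial further subsequence already gives the contradiction.\<close>
  from this(2)[OF strict_mono_id] have "o_Cauchy (cesaro_means (x \<circ> r))" by simp
  moreover have "\<not> o_Cauchy (cesaro_means (x \<circ> r))"
  proof (rule not_o_Cauchy_of_dense_oscillation[OF assms(1,2,3), of "1 / 8"])
    fix k W assume "open W" "W \<noteq> {}" "W \<subseteq> U"
    then obtain l where l: "V l \<subseteq> W" using base by blast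
    \<comment> \<open>The summand \<open>k\<close> makes both indices late; the factors 4 and 8 are
      the length ratios that \<open>cesaro_means_oscillate\<close> asks for.\<close>
    define n where "n = 4 * l + k"
    define m where "m = 8 * Suc n"
    \<comment> \<open>The pattern switches at \<open>r n\<close>. Since \<open>r\<close> is strictly
      increasing, \<open>r j \<le> r n\<close> exactly when \<open>j \<le> n\<close>, and
      \<open>j \<le> r j\<close> keeps the indices in the range controlled on
      \<open>V l\<close>.\<close>
    obtain t where t: "t \<in> V l" "\<forall>i\<in>{l..<Suc (r m)}. t \<in> high_low (x i) (i \<le> r n)"
      using pattern[of l "Suc (r m)" "\<lambda>i. i \<le> r n"] by blast
    have rj: "r j \<in> {l..<Suc (r m)}" if "l \<le> j" "j \<le> m" for j
      using that strict_mono_imp_increasing[OF r, of j] strict_mono_less_eq[OF r, of j m] by auto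
    have "1 / 8 \<le> \<bar>cesaro_means (\<lambda>j. (x \<circ> r) j t) n - cesaro_means (\<lambda>j. (x \<circ> r) j t) m\<bar>"
    proof (rule cesaro_means_oscillate[where l = l])
      show "3 / 4 \<le> (x \<circ> r) j t" if "l \<le> j" "j \<le> n" for j
        using t(2) rj[of j] that strict_mono_less_eq[OF r, of j n]
        by (fastforce simp: high_low_def m_def)
      show "(x \<circ> r) j t \<le> 1 / 4" if "n < j" "j \<le> m" for j
        using t(2) rj[of j] that strict_mono_less_eq[OF r, of j n]
        by (fastforce simp: high_low_def n_def)
    qed (use x in \<open>auto simp: n_def m_def\<close>)
    moreover have "k \<le> n" "k \<le> m" by (auto simp: n_def m_def)
    ultimately show "\<exists>t\<in>W. \<exists>n\<ge>k. \<exists>m\<ge>k. 1 / 8 \<le>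
        \<bar>cesaro_means (x \<circ> r) n t - cesaro_means (x \<circ> r) m t\<bar>"
      using t(1) l unfolding cesaro_means_bcontfun by blast
  qed simp
  ultimately show False by contradiction
qed

end
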